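(* Let $Z\subset\{0,1\}^n$ be a code of size $N$ with distance distribution $(A_w)_{w=0}^n$ and dual distance distribution $(A_k^\perp)_{k=0}^n$. Then $$D^{L_2}(Z)=\frac1{2^n}\sum_{k=1}^nA_k^\perp\sum_{t=0}^{n-1}\big(K_t^{(n-1)}(k-1)\big)^2=\frac1{2^n}\sum_{k=1}^nA_k^\perp\sum_{i=0}^{\lfloor(n-1)/2\rfloor}2^{n-1-2i}\binom{2i}iK_{2i}^{(n-1)}(k-1).$$
   Context: $d$ is the Hamming distance, $B(x,t)=\{y:d(x,y)\le t\}$, and for $Z=\{z_1,\dots,z_N\}$, $D^{L_2}(Z)=\sum_{t=0}^n\sum_{x\in\{0,1\}^n}\Big(\frac1N\sum_{j=1}^N\mathbb 1_{B(x,t)}(z_j)-\frac{|B(x,t)|}{2^n}\Big)^2$. The distance distribution is $A_w=\frac1N|\{(z,z')\in Z^2:d(z,z')=w\}|$. Krawtchouk polynomials: $K_k^{(m)}(x)=\sum_{i=0}^k(-1)^i\binom xi\binom{m-x}{k-i}$. The dual distance distribution is $A_k^\perp=\frac1N\sum_{i=0}^nK_k^{(n)}(i)A_i$, $k=0,\dots,n$. *)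

theory Defs
  imports Complex_Main "HOL-Library.Indicator_Function"
begin

definition binary_cube :: "nat \<Rightarrow> bool list set" where
  "binary_cube n = {x. length x = n}"

definition hamming_dist :: "bool list \<Rightarrow> bool list \<Rightarrow> nat" where
  "hamming_dist x y = card {i. i < length x \<and> x ! i \<noteq> y ! i}"

definition hamming_ball :: "nat \<Rightarrow> bool list \<Rightarrow> nat \<Rightarrow> bool list set" where
  "hamming_ball n x t = {y \<in> binary_cube n. hamming_dist x y \<le> t}"

definition L2_discrepancy :: "nat \<Rightarrow> bool list set \<Rightarrow> real" where
  "L2_discrepancy n Z =
     (\<Sum>t=0..n. \<Sum>x\<in>binary_cube n.
        ((1 / real (card Z)) * (\<Sum>z\<in>Z. indicator (hamming_ball n x t) z)
          - real (card (hamming_ball n x t)) / 2 ^ n)\<^sup>2)"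

definition distance_distribution :: "bool list set \<Rightarrow> nat \<Rightarrow> real" where
  "distance_distribution Z w =
     (1 / real (card Z)) * real (card {(z, z'). z \<in> Z \<and> z' \<in> Z \<and> hamming_dist z z' = w})"

text \<open>The binomial coefficients in the Krawtchouk polynomial of degree \<open>k\<close> are themselves
  polynomials in the argument \<open>x\<close>, hence the generalised binomial coefficients.\<close>

definition krawtchouk :: "nat \<Rightarrow> nat \<Rightarrow> real \<Rightarrow> real" where
  "krawtchouk m k x =
     (\<Sum>i=0..k. (- 1) ^ i * (x gchoose i) * ((real m - x) gchoose (k - i)))"

definition dual_distance_distribution :: "nat \<Rightarrow> bool list set \<Rightarrow> nat \<Rightarrow> real" where
  "dual_distance_distribution n Z k =
     (1 / real (card Z)) * (\<Sum>i=0..n. krawtchouk n k (real i) * distance_distribution Z i)"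

end

theory Submission
  imports Defs "HOL-Computational_Algebra.Polynomial"
begin

text \<open>
  In the Walsh basis of the binary cube, the indicator of a ball of radius \<open>t\<close> has as coefficient
  at a word of weight \<open>k \<ge> 1\<close> the partial sum of \<open>K_j^(n)(k)\<close> over \<open>j \<le> t\<close>, which telescopes to
  \<open>K_t^(n-1)(k-1)\<close>; the coefficient at \<open>0\<close> is the ball volume, which the discrepancy subtracts.
  Since the squared character sums of \<open>Z\<close> over words of weight \<open>k\<close> add up to the dual distance
  distribution, Parseval gives the first formula. The second one evaluates the sum of squares of
  Krawtchouk numbers as a constant term.
\<close>

section \<open>Krawtchouk polynomials as coefficients\<close>

text \<open>The subtraction \<open>m - x\<close> is truncated, so this is the Krawtchouk generating
  function only for \<open>x \<le> m\<close>.\<close>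

definition krawtchouk_gf :: "nat \<Rightarrow> nat \<Rightarrow> real poly" where
  "krawtchouk_gf m x = [:1, -1:] ^ x * [:1, 1:] ^ (m - x)"

lemma coeff_linear_power:
  fixes c :: "'a::comm_ring_1"
  shows "coeff ([:1, c:] ^ n) k = of_nat (n choose k) * c ^ k"
proof (induction n arbitrary: k)
  case 0
  then show ?case by (cases k) auto
next
  case (Suc n)
  then show ?case by (cases k) (auto simp: algebra_simps)
qed

lemma krawtchouk_eq_coeff:
  assumes "x \<le> m"
  shows "krawtchouk m k (real x) = coeff (krawtchouk_gf m x) k"
proof -
  have "real m - real x = real (m - x)"
    using assms by simp
  then show ?thesis
    by (simp add: krawtchouk_def krawtchouk_gf_def coeff_mult coeff_linear_power
        binomial_gbinomial atLeast0AtMost mult_ac del: of_nat_diff)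
qed

lemma krawtchouk_gf_Suc_Suc: "krawtchouk_gf (Suc m) (Suc x) = [:1, -1:] * krawtchouk_gf m x"
  by (simp add: krawtchouk_gf_def mult.assoc del: mult_pCons_left)

lemma degree_krawtchouk_gf_le:
  assumes "x \<le> m"
  shows "degree (krawtchouk_gf m x) \<le> m"
proof -
  have "degree ([:1, c:] ^ k) \<le> k" for c :: real and k
    using degree_power_le[of "[:1, c:]" k] degree_pCons_le[of 1 "[:c:]"]
    by (simp split: if_splits)
  then have "degree (krawtchouk_gf m x) \<le> x + (m - x)"
    unfolding krawtchouk_gf_def by (intro order.trans[OF degree_mult_le] add_mono) auto
  then show ?thesis using assms by simp
qed

text \<open>Multiplication by \<open>1 - X\<close> takes backward differences of coefficients, so
  partial sums telescope. This collapses a ball into a single Krawtchouk value.\<close>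

lemma sum_coeff_mult_linear:
  fixes P :: "real poly"
  shows "(\<Sum>j\<le>t. coeff ([:1, -1:] * P) j) = coeff P t"
  by (induction t) auto

text \<open>The constant term 1 of the linear factor contributes an extra \<open>b\<close>; the term
  \<open>c X\<close> shifts the index and contributes \<open>c a\<close>. The degree bound removes
  the top coefficient, which has no factor \<open>b\<close> to split off.\<close>

lemma homogenise_linear_mult:
  fixes P a b :: "real poly"
  assumes "degree P \<le> n"
  shows "(\<Sum>k\<le>Suc n. smult (coeff ([:1, c:] * P) k) (a ^ k * b ^ (Suc n - k))) =
         (b + smult c a) * (\<Sum>k\<le>n. smult (coeff P k) (a ^ k * b ^ (n - k)))"
proof -
  have top: "coeff P (Suc n) = 0"
    using assms by (simp add: coeff_eq_0)
  have "coeff ([:1, c:] * P) k = coeff P k + (case k of 0 \<Rightarrow> 0 | Suc j \<Rightarrow> c * coeff P j)" for k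
    by (cases k) auto
  then have "(\<Sum>k\<le>Suc n. smult (coeff ([:1, c:] * P) k) (a ^ k * b ^ (Suc n - k))) =
      (\<Sum>k\<le>Suc n. smult (coeff P k) (a ^ k * b ^ (Suc n - k))) +
      (\<Sum>k\<le>Suc n. smult (case k of 0 \<Rightarrow> 0 | Suc j \<Rightarrow> c * coeff P j) (a ^ k * b ^ (Suc n - k)))"
    by (simp only: smult_add_left sum.distrib)
  also have "(\<Sum>k\<le>Suc n. smult (coeff P k) (a ^ k * b ^ (Suc n - k))) =
      b * (\<Sum>k\<le>n. smult (coeff P k) (a ^ k * b ^ (n - k)))"
    by (simp add: top sum_distrib_left Suc_diff_le mult_ac)
  also have "(\<Sum>k\<le>Suc n. smult (case k of 0 \<Rightarrow> 0 | Suc j \<Rightarrow> c * coeff P j)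
        (a ^ k * b ^ (Suc n - k))) =
      smult c a * (\<Sum>k\<le>n. smult (coeff P k) (a ^ k * b ^ (n - k)))"
    by (subst sum.atMost_Suc_shift) (simp add: sum_distrib_left smult_sum mult_ac)
  finally show ?thesis by (simp add: algebra_simps)
qed

text \<open>Induction peels off one factor, \<open>1 + X\<close> if \<open>x = 0\<close> and
  \<open>1 - X\<close> otherwise. Used twice: \<open>(a, b) = (1, X)\<close> reverses the generating
  function, and \<open>(1 + X^2, 2 X)\<close> expands its product with the reversal.\<close>

lemma homogeneous_krawtchouk_gf:
  fixes a b :: "real poly"
  assumes "x \<le> m"
  shows "(\<Sum>k\<le>m. smult (coeff (krawtchouk_gf m x) k) (a ^ k * b ^ (m - k))) =
         (b - a) ^ x * (b + a) ^ (m - x)"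
  using assms
proof (induction m arbitrary: x)
  case 0
  then show ?case by (simp add: krawtchouk_gf_def)
next
  case (Suc m)
  show ?case
  proof (cases x)
    case 0
    have "krawtchouk_gf (Suc m) 0 = [:1, 1:] * krawtchouk_gf m 0"
      by (simp add: krawtchouk_gf_def)
    then show ?thesis
      using homogenise_linear_mult[OF degree_krawtchouk_gf_le, of 0 m 1 a b] Suc.IH[of 0] 0
      by simp
  next
    case (Suc y)
    with Suc.prems have "y \<le> m" by simp
    then show ?thesis
      using homogenise_linear_mult[OF degree_krawtchouk_gf_le, of y m "-1" a b] Suc.IH[of y] Suc
      by (simp add: krawtchouk_gf_Suc_Suc mult.assoc del: mult_pCons_left)
  qed
qed

text \<open>This is the constant term of \<open>(X + 1/X)^k\<close>, hence a central binomial
  coefficient or zero.\<close>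

lemma coeff_one_plus_square_power:
  "coeff ([:1, 0, 1:] ^ k :: real poly) k = (if even k then real (k choose (k div 2)) else 0)"
proof -
  have "([:1, 0, 1:] :: real poly) = monom 1 2 + 1"
    by (simp add: monom_altdef numeral_2_eq_2 one_pCons)
  then have "([:1, 0, 1:] ^ k :: real poly) = (\<Sum>i\<le>k. of_nat (k choose i) * monom 1 (2 * i))"
    by (simp add: binomial_ring monom_power)
  then have "coeff ([:1, 0, 1:] ^ k :: real poly) k =
      (\<Sum>i\<le>k. real (k choose i) * (if 2 * i = k then 1 else 0))"
    by (simp add: coeff_sum of_nat_poly)
  also have "\<dots> = (\<Sum>i\<le>k. if even k \<and> i = k div 2 then real (k choose i) else 0)"
    by (intro sum.cong) auto
  also have "\<dots> = (if even k then real (k choose (k div 2)) else 0)"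
    by (cases "even k") (simp_all add: sum.delta)
  finally show ?thesis .
qed

text \<open>With \<open>P\<close> the generating function, the sum of squares is the constant term of
  \<open>P(X) P(1/X) = (2 - w)^x (2 + w)^(m-x)\<close>, where \<open>w = X + 1/X\<close>; everything is multiplied by
  \<open>X^m\<close> to stay within polynomials.\<close>

lemma sum_krawtchouk_squares:
  assumes "x \<le> m"
  shows "(\<Sum>t=0..m. (krawtchouk m t (real x))\<^sup>2) =
         (\<Sum>i=0..m div 2. 2 ^ (m - 2 * i) * real ((2 * i) choose i)
            * krawtchouk m (2 * i) (real x))"
proof -
  define P where "P = krawtchouk_gf m x"
  \<comment> \<open>\<open>Q\<close> is \<open>X^m P(1/X)\<close>, the coefficients of
    \<open>P\<close> in reverse order.\<close>
  define Q :: "real poly" where "Q = ([:0, 1:] - 1) ^ x * ([:0, 1:] + 1) ^ (m - x)"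
  have "Q = (\<Sum>k\<le>m. smult (coeff P k) ([:0, 1:] ^ (m - k)))"
    using homogeneous_krawtchouk_gf[OF assms, of 1 "[:0, 1:]"] by (simp add: P_def Q_def)
  then have Q: "Q = (\<Sum>k\<le>m. monom (coeff P k) (m - k))"
    by (simp add: monom_altdef)
  have reflect: "coeff Q (m - t) = coeff P t" if "t \<le> m" for t
  proof -
    have "coeff Q (m - t) = (\<Sum>k\<le>m. if k = t then coeff P k else 0)"
      unfolding Q coeff_sum coeff_monom using that by (intro sum.cong) auto
    then show ?thesis using that by simp
  qed
  have "P * Q = ([:1, -1:] * ([:0, 1:] - 1)) ^ x * ([:1, 1:] * ([:0, 1:] + 1)) ^ (m - x)"
    by (simp only: P_def Q_def krawtchouk_gf_def power_mult_distrib mult_ac)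
  \<comment> \<open>Here \<open>(1 - X)(X - 1) = 2 X - (1 + X^2)\<close> and
    \<open>(1 + X)(X + 1) = 2 X + (1 + X^2)\<close>.\<close>
  also have "\<dots> = ([:0, 2:] - [:1, 0, 1:]) ^ x * ([:0, 2:] + [:1, 0, 1:]) ^ (m - x)"
    by (simp add: one_pCons)
  also have "\<dots> = (\<Sum>k\<le>m. smult (coeff P k) ([:1, 0, 1:] ^ k * [:0, 2:] ^ (m - k)))"
    using homogeneous_krawtchouk_gf[OF assms, of "[:1, 0, 1:]" "[:0, 2:]"] by (simp add: P_def)
  also have "\<dots> = (\<Sum>k\<le>m. monom (coeff P k * 2 ^ (m - k)) (m - k) * [:1, 0, 1:] ^ k)"
  proof (intro sum.cong refl)
    fix k
    have "([:0, 2:] :: real poly) = monom 2 1"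
      by (simp add: monom_altdef)
    then have "smult (coeff P k) ([:0, 2:] ^ (m - k)) = monom (coeff P k * 2 ^ (m - k)) (m - k)"
      by (simp add: monom_power smult_monom)
    then show "smult (coeff P k) ([:1, 0, 1:] ^ k * [:0, 2:] ^ (m - k)) =
        monom (coeff P k * 2 ^ (m - k)) (m - k) * [:1, 0, 1:] ^ k"
      by (metis mult_smult_right mult.commute)
  qed
  \<comment> \<open>The monomial of degree \<open>m - k\<close> turns the coefficient at
    \<open>m\<close> into the one at \<open>k\<close> of \<open>(1 + X^2)^k\<close>.\<close>
  finally have PQ: "coeff (P * Q) m =
      (\<Sum>k\<le>m. coeff P k * 2 ^ (m - k) * (if even k then real (k choose (k div 2)) else 0))"
    by (auto simp: coeff_sum coeff_monom_mult coeff_one_plus_square_power intro!: sum.cong)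
  have "(\<Sum>t=0..m. (krawtchouk m t (real x))\<^sup>2) = (\<Sum>t\<le>m. coeff P t * coeff Q (m - t))"
    by (simp add: krawtchouk_eq_coeff[OF assms] reflect P_def[symmetric] atLeast0AtMost
        power2_eq_square)
  also have "\<dots> = coeff (P * Q) m"
    by (simp add: coeff_mult)
  also have "\<dots> = (\<Sum>k\<in>{k. k \<le> m \<and> even k}. coeff P k * 2 ^ (m - k) * real (k choose (k div 2)))"
    unfolding PQ by (intro sum.mono_neutral_cong_right) auto
  also have "\<dots> = (\<Sum>i=0..m div 2. 2 ^ (m - 2 * i) * real ((2 * i) choose i)
            * krawtchouk m (2 * i) (real x))"
    by (rule sum.reindex_bij_witness[of _ "\<lambda>i. 2 * i" "\<lambda>k. k div 2"])
       (auto simp: krawtchouk_eq_coeff[OF assms] P_def)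
  finally show ?thesis .
qed

section \<open>Characters of the binary cube\<close>

text \<open>The character \<open>(-1)^<u,z>\<close>. Its values lie in any commutative ring, so that
  sums over the cube can also be computed in \<open>real poly\<close>.\<close>

fun walsh :: "bool list \<Rightarrow> bool list \<Rightarrow> 'a::comm_ring_1" where
  "walsh (a # u) (b # z) = (if a \<and> b then -1 else 1) * walsh u z"
| "walsh _ _ = 1"

definition hamming_weight :: "bool list \<Rightarrow> nat" where
  "hamming_weight u = length (filter id u)"

lemma hamming_weight_le: "u \<in> binary_cube n \<Longrightarrow> hamming_weight u \<le> n"
  by (auto simp: hamming_weight_def binary_cube_def)

lemma hamming_weight_eq_0_iff:
  assumes "u \<in> binary_cube n"
  shows "hamming_weight u = 0 \<longleftrightarrow> u = replicate n False"
proof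
  assume "hamming_weight u = 0"
  with assms show "u = replicate n False"
    by (auto simp: hamming_weight_def binary_cube_def filter_empty_conv intro!: replicate_eqI)
next
  assume "u = replicate n False"
  then show "hamming_weight u = 0"
    by (simp add: hamming_weight_def)
qed

lemma walsh_commute: "walsh u z = walsh z u"
  by (induction u z rule: walsh.induct) auto

lemma walsh_replicate_False [simp]: "walsh (replicate n False) z = 1"
proof (induction n arbitrary: z)
  case (Suc n)
  then show ?case by (cases z) auto
qed simp

text \<open>The left side is a polynomial, the argument on the right a coefficient; this moves signs
  out of polynomial identities as scalars.\<close>

lemma walsh_poly: "walsh u z = [:walsh u z:]"
  by (induction u z rule: walsh.induct) (auto simp: one_pCons)

section \<open>Hamming distance and recursion on the cube\<close>

lemma hamming_dist_Cons:
  "hamming_dist (a # x) (b # y) = (if a = b then 0 else 1) + hamming_dist x y"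
proof -
  have "{i. i < length (a # x) \<and> (a # x) ! i \<noteq> (b # y) ! i} =
      (if a = b then {} else {0}) \<union> Suc ` {i. i < length x \<and> x ! i \<noteq> y ! i}"
    by (auto simp: less_Suc_eq_0_disj image_iff)
  then show ?thesis
    unfolding hamming_dist_def by (auto simp: card_insert_if card_image)
qed

lemma hamming_dist_le: "hamming_dist x y \<le> length x"
  unfolding hamming_dist_def by (rule order.trans[OF card_mono[of "{..<length x}"]]) auto

lemma hamming_dist_eq_0_iff:
  "length x = length y \<Longrightarrow> hamming_dist x y = 0 \<longleftrightarrow> x = y"
  by (simp add: hamming_dist_def list_eq_iff_nth_eq)

lemma binary_cube_Suc:
  "binary_cube (Suc n) = Cons True ` binary_cube n \<union> Cons False ` binary_cube n"
  unfolding binary_cube_def by (auto simp: length_Suc_conv image_iff)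

lemma finite_binary_cube [simp]: "finite (binary_cube n)"
  by (induction n) (simp_all add: binary_cube_Suc, simp add: binary_cube_def)

lemma sum_binary_cube_Suc:
  fixes f :: "bool list \<Rightarrow> 'a::comm_monoid_add"
  shows "(\<Sum>u\<in>binary_cube (Suc n). f u) =
    (\<Sum>u\<in>binary_cube n. f (True # u)) + (\<Sum>u\<in>binary_cube n. f (False # u))"
  unfolding binary_cube_Suc
  by (subst sum.union_disjoint) (auto simp: sum.reindex)

text \<open>The values \<open>(a, b) = (X, 1)\<close>, \<open>(1 - X, 1 + X)\<close> and \<open>(1, 1)\<close> give the Krawtchouk
  generating function, its inversion, and orthogonality of characters.\<close>

lemma sum_walsh_weight:
  fixes a b :: "'a::comm_ring_1"
  assumes "length x = n" and "length z = n"
  shows "(\<Sum>u\<in>binary_cube n. walsh u x * walsh u z *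
            (a ^ hamming_weight u * b ^ (n - hamming_weight u))) =
         (b - a) ^ hamming_dist x z * (b + a) ^ (n - hamming_dist x z)"
  using assms
proof (induction n arbitrary: x z)
  case 0
  then show ?case by (simp add: binary_cube_def hamming_weight_def hamming_dist_def)
next
  case (Suc n)
  then obtain c x' d z' where xz: "x = c # x'" "z = d # z'" "length x' = n" "length z' = n"
    by (auto simp: length_Suc_conv)
  \<comment> \<open>The sign from a leading \<open>True\<close> in \<open>u\<close>: the total
    factor \<open>s * a + b\<close> is \<open>b + a\<close> where the first letters agree and
    \<open>b - a\<close> where they differ.\<close>
  define s where "s = (if c = d then 1 else -1 :: 'a)"
  define S where "S = (\<Sum>u\<in>binary_cube n. walsh u x' * walsh u z' *
            (a ^ hamming_weight u * b ^ (n - hamming_weight u)))"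
  have T: "(\<Sum>u\<in>binary_cube n. walsh (True # u) x * walsh (True # u) z *
            (a ^ hamming_weight (True # u) * b ^ (Suc n - hamming_weight (True # u)))) = s * a * S"
    unfolding S_def sum_distrib_left
    by (intro sum.cong refl) (auto simp: xz s_def hamming_weight_def)
  have F: "(\<Sum>u\<in>binary_cube n. walsh (False # u) x * walsh (False # u) z *
            (a ^ hamming_weight (False # u) * b ^ (Suc n - hamming_weight (False # u)))) = b * S"
    unfolding S_def sum_distrib_left
  proof (intro sum.cong refl)
    fix u assume "u \<in> binary_cube n"
    then have "hamming_weight u \<le> n" by (rule hamming_weight_le)
    then have "Suc n - hamming_weight (False # u) = Suc (n - hamming_weight u)"
      by (simp add: hamming_weight_def Suc_diff_le)
    then show "walsh (False # u) x * walsh (False # u) z *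
            (a ^ hamming_weight (False # u) * b ^ (Suc n - hamming_weight (False # u))) =
        b * (walsh u x' * walsh u z' * (a ^ hamming_weight u * b ^ (n - hamming_weight u)))"
      by (simp add: xz hamming_weight_def mult_ac)
  qed
  have S: "S = (b - a) ^ hamming_dist x' z' * (b + a) ^ (n - hamming_dist x' z')"
    unfolding S_def using xz by (intro Suc.IH)
  have "hamming_dist x' z' \<le> n"
    using hamming_dist_le[of x' z'] xz by simp
  then show ?case
    unfolding sum_binary_cube_Suc T F unfolding S
    by (auto simp: xz s_def hamming_dist_Cons Suc_diff_le algebra_simps)
qed

text \<open>With \<open>a = X\<close> the degree records the weight of \<open>u\<close>, so
  extracting one coefficient restricts the sum to a sphere.\<close>

lemma sum_walsh_eq_coeff_krawtchouk_gf:
  assumes "length x = n" and "length z = n"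
  shows "(\<Sum>u | u \<in> binary_cube n \<and> hamming_weight u = k. walsh u x * walsh u z) =
         coeff (krawtchouk_gf n (hamming_dist x z)) k"
proof -
  have "krawtchouk_gf n (hamming_dist x z) =
      (\<Sum>u\<in>binary_cube n. walsh u x * walsh u z *
        ([:0, 1:] ^ hamming_weight u * 1 ^ (n - hamming_weight u)))"
    unfolding sum_walsh_weight[OF assms] by (simp add: krawtchouk_gf_def one_pCons)
  also have "\<dots> = (\<Sum>u\<in>binary_cube n. monom (walsh u x * walsh u z) (hamming_weight u))"
    by (intro sum.cong refl) (simp add: walsh_poly[where 'a = real] monom_altdef mult.commute)
  finally have "coeff (krawtchouk_gf n (hamming_dist x z)) k =
      (\<Sum>u\<in>binary_cube n. if hamming_weight u = k then walsh u x * walsh u z else 0)"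
    by (simp add: coeff_sum)
  then show ?thesis
    by (simp add: sum.inter_filter)
qed

text \<open>For \<open>a = 1 - X\<close> and \<open>b = 1 + X\<close> one has
  \<open>b - a = 2 X\<close> and \<open>b + a = 2\<close>, so a single power of \<open>X\<close>
  survives. Up to the factor \<open>2 ^ n\<close> this is the Walsh expansion of the indicator of a
  sphere.\<close>

lemma sum_walsh_coeff_krawtchouk_gf:
  assumes "length x = n" and "length z = n"
  shows "(\<Sum>u\<in>binary_cube n. walsh u x * walsh u z * coeff (krawtchouk_gf n (hamming_weight u)) j) =
         (if hamming_dist x z = j then 2 ^ n else 0)"
proof -
  have d: "hamming_dist x z \<le> n"
    using hamming_dist_le[of x z] assms by simp
  have "(\<Sum>u\<in>binary_cube n. smult (walsh u x * walsh u z) (krawtchouk_gf n (hamming_weight u))) =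
      (\<Sum>u\<in>binary_cube n. walsh u x * walsh u z *
        ([:1, -1:] ^ hamming_weight u * [:1, 1:] ^ (n - hamming_weight u)))"
    by (intro sum.cong refl) (simp add: walsh_poly[where 'a = real] krawtchouk_gf_def mult.commute)
  also have "\<dots> = ([:1, 1:] - [:1, -1:]) ^ hamming_dist x z *
      ([:1, 1:] + [:1, -1:]) ^ (n - hamming_dist x z)"
    by (rule sum_walsh_weight[OF assms])
  also have "\<dots> = monom 2 1 ^ hamming_dist x z * monom 2 0 ^ (n - hamming_dist x z)"
    by (simp add: monom_altdef)
  also have "\<dots> = monom (2 ^ n) (hamming_dist x z)"
    using d by (simp add: monom_power mult_monom flip: power_add)
  finally have "coeff (\<Sum>u\<in>binary_cube n. smult (walsh u x * walsh u z)
        (krawtchouk_gf n (hamming_weight u))) j = coeff (monom (2 ^ n) (hamming_dist x z)) j"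
    by simp
  then show ?thesis by (simp add: coeff_sum)
qed

lemma walsh_orthogonal:
  assumes "u \<in> binary_cube n" and "v \<in> binary_cube n"
  shows "(\<Sum>x\<in>binary_cube n. walsh u x * walsh v x :: real) = (if u = v then 2 ^ n else 0)"
proof -
  have "(\<Sum>x\<in>binary_cube n. walsh u x * walsh v x :: real) =
      (\<Sum>x\<in>binary_cube n. walsh x u * walsh x v)"
    by (intro sum.cong refl arg_cong2[of _ _ _ _ "(*)"] walsh_commute)
  \<comment> \<open>At \<open>a = b = 1\<close> the factor \<open>b - a\<close> is 0, and
    \<open>0 ^ 0 = 1\<close> singles out \<open>u = v\<close>.\<close>
  also have "\<dots> = 0 ^ hamming_dist u v * 2 ^ (n - hamming_dist u v)"
    using sum_walsh_weight[of u n v "1::real" 1] assms by (simp add: binary_cube_def)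
  finally have "(\<Sum>x\<in>binary_cube n. walsh u x * walsh v x :: real) =
      0 ^ hamming_dist u v * 2 ^ (n - hamming_dist u v)" .
  then show ?thesis
    using assms hamming_dist_eq_0_iff[of u v] by (auto simp: binary_cube_def)
qed

section \<open>The discrepancy\<close>

text \<open>The Walsh coefficient, before division by \<open>2 ^ n\<close>, of the ball of radius
  \<open>t\<close> around the zero word, at any word of weight \<open>w\<close>.\<close>

definition ball_coeff :: "nat \<Rightarrow> nat \<Rightarrow> nat \<Rightarrow> real" where
  "ball_coeff n t w = (\<Sum>j\<le>t. coeff (krawtchouk_gf n w) j)"

text \<open>A positive weight supplies the factor \<open>1 - X\<close> needed for telescoping;
  removing it lowers length and argument by one.\<close>

lemma ball_coeff_eq_krawtchouk:
  assumes "1 \<le> w" and "w \<le> n"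
  shows "ball_coeff n t w = krawtchouk (n - 1) t (real w - 1)"
proof -
  obtain m v where mv: "n = Suc m" "w = Suc v" "v \<le> m"
    using assms by (cases n; cases w) auto
  then show ?thesis
    using krawtchouk_eq_coeff[of v m t]
    by (simp add: ball_coeff_def krawtchouk_gf_Suc_Suc sum_coeff_mult_linear
        del: mult_pCons_left)
qed

text \<open>A ball is the disjoint union of its spheres, each already expanded.\<close>

lemma indicator_hamming_ball_eq:
  assumes "x \<in> binary_cube n" and "z \<in> binary_cube n"
  shows "(indicator (hamming_ball n x t) z :: real) =
    (\<Sum>u\<in>binary_cube n. walsh u x * walsh u z * ball_coeff n t (hamming_weight u)) / 2 ^ n"
proof -
  have l: "length x = n" "length z = n"
    using assms by (auto simp: binary_cube_def)
  have "(\<Sum>u\<in>binary_cube n. walsh u x * walsh u z * ball_coeff n t (hamming_weight u)) =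
      (\<Sum>j\<le>t. \<Sum>u\<in>binary_cube n. walsh u x * walsh u z *
        coeff (krawtchouk_gf n (hamming_weight u)) j)"
    unfolding ball_coeff_def sum_distrib_left by (rule sum.swap)
  also have "\<dots> = (\<Sum>j\<le>t. if hamming_dist x z = j then 2 ^ n else 0)"
    by (simp add: sum_walsh_coeff_krawtchouk_gf[OF l])
  also have "\<dots> = (if hamming_dist x z \<le> t then 2 ^ n else 0)"
    by simp
  finally show ?thesis
    using assms by (simp add: hamming_ball_def indicator_def)
qed

lemma card_hamming_ball_eq:
  assumes "x \<in> binary_cube n"
  shows "real (card (hamming_ball n x t)) = ball_coeff n t 0"
proof -
  let ?o = "replicate n False"
  have o: "?o \<in> binary_cube n" by (simp add: binary_cube_def)
  have "real (card (hamming_ball n x t)) =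
      (\<Sum>z\<in>binary_cube n. indicator (hamming_ball n x t) z)"
    by (simp add: sum.If_cases indicator_def hamming_ball_def Int_def)
  also have "\<dots> = (\<Sum>z\<in>binary_cube n. \<Sum>u\<in>binary_cube n.
      walsh u x * walsh u z * ball_coeff n t (hamming_weight u)) / 2 ^ n"
    by (simp add: indicator_hamming_ball_eq[OF assms] sum_divide_distrib)
  \<comment> \<open>The factor \<open>walsh ?o z\<close> equals 1; it makes the inner sum an
    instance of orthogonality, which leaves only \<open>u = ?o\<close>.\<close>
  also have "(\<Sum>z\<in>binary_cube n. \<Sum>u\<in>binary_cube n.
      walsh u x * walsh u z * ball_coeff n t (hamming_weight u)) =
      (\<Sum>u\<in>binary_cube n. walsh u x * ball_coeff n t (hamming_weight u) *
        (\<Sum>z\<in>binary_cube n. walsh u z * walsh ?o z))"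
    by (subst sum.swap) (simp add: sum_distrib_left sum_distrib_right mult_ac)
  also have "\<dots> = (\<Sum>u\<in>binary_cube n. if u = ?o then
      walsh u x * ball_coeff n t (hamming_weight u) * 2 ^ n else 0)"
    using o by (intro sum.cong refl) (simp only: walsh_orthogonal, simp)
  also have "\<dots> = ball_coeff n t 0 * 2 ^ n"
    using o by (simp add: hamming_weight_def)
  finally show ?thesis by simp
qed

text \<open>Orthogonality kills the cross terms of the expanded square. A general \<open>U\<close>
  allows the zero word to be left out.\<close>

lemma walsh_parseval:
  fixes c :: "bool list \<Rightarrow> real"
  assumes "U \<subseteq> binary_cube n"
  shows "(\<Sum>x\<in>binary_cube n. (\<Sum>u\<in>U. c u * walsh u x)\<^sup>2) = 2 ^ n * (\<Sum>u\<in>U. (c u)\<^sup>2)"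
proof -
  have [simp]: "finite U" using assms by (rule finite_subset) simp
  have "(\<Sum>x\<in>binary_cube n. (\<Sum>u\<in>U. c u * walsh u x)\<^sup>2) =
      (\<Sum>x\<in>binary_cube n. \<Sum>u\<in>U. \<Sum>v\<in>U. c u * c v * (walsh u x * walsh v x))"
    by (simp add: power2_eq_square sum_product mult_ac)
  also have "\<dots> = (\<Sum>u\<in>U. \<Sum>v\<in>U. \<Sum>x\<in>binary_cube n. c u * c v * (walsh u x * walsh v x))"
    by (subst sum.swap, rule sum.cong[OF refl], rule sum.swap)
  also have "\<dots> = (\<Sum>u\<in>U. \<Sum>v\<in>U. c u * c v * (if u = v then 2 ^ n else 0))"
    using assms by (intro sum.cong refl) (auto simp: walsh_orthogonal subset_iff
        simp flip: sum_distrib_left)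
  also have "\<dots> = (\<Sum>u\<in>U. 2 ^ n * (c u)\<^sup>2)"
    by (intro sum.cong refl) (simp add: if_distrib[of "\<lambda>s. _ * s"] power2_eq_square cong: if_cong)
  finally show ?thesis by (simp add: sum_distrib_left)
qed

section \<open>Pair counts and the spectrum of the code\<close>

lemma sum_pairs_by_distance:
  fixes f :: "nat \<Rightarrow> real"
  assumes "Z \<subseteq> binary_cube n"
  shows "(\<Sum>z\<in>Z. \<Sum>z'\<in>Z. f (hamming_dist z z')) =
    (\<Sum>i=0..n. f i * real (card {(z, z'). z \<in> Z \<and> z' \<in> Z \<and> hamming_dist z z' = i}))"
proof -
  have fin: "finite (Z \<times> Z)" using finite_subset[OF assms] by simp
  have "(\<lambda>(z, z'). hamming_dist z z') ` (Z \<times> Z) \<subseteq> {0..n}"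
    using assms hamming_dist_le by (fastforce simp: binary_cube_def)
  then have "(\<Sum>p\<in>Z \<times> Z. f (case p of (z, z') \<Rightarrow> hamming_dist z z')) =
      (\<Sum>i=0..n. \<Sum>p | p \<in> Z \<times> Z \<and> (case p of (z, z') \<Rightarrow> hamming_dist z z') = i.
        f (case p of (z, z') \<Rightarrow> hamming_dist z z'))"
    using fin by (intro sum.group[symmetric]) auto
  also have "\<dots> = (\<Sum>i=0..n. f i *
      real (card {(z, z'). z \<in> Z \<and> z' \<in> Z \<and> hamming_dist z z' = i}))"
  proof (intro sum.cong refl)
    fix i
    have pairs: "{p. p \<in> Z \<times> Z \<and> (case p of (z, z') \<Rightarrow> hamming_dist z z') = i} =
        {(z, z'). z \<in> Z \<and> z' \<in> Z \<and> hamming_dist z z' = i}"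
      by auto
    show "(\<Sum>p | p \<in> Z \<times> Z \<and> (case p of (z, z') \<Rightarrow> hamming_dist z z') = i.
        f (case p of (z, z') \<Rightarrow> hamming_dist z z')) =
        f i * real (card {(z, z'). z \<in> Z \<and> z' \<in> Z \<and> hamming_dist z z' = i})"
      unfolding pairs[symmetric] by simp
  qed
  finally show ?thesis by (simp add: sum.cartesian_product case_prod_unfold)
qed

definition code_transform :: "bool list set \<Rightarrow> bool list \<Rightarrow> real" where
  "code_transform Z u = (1 / real (card Z)) * (\<Sum>z\<in>Z. walsh u z)"

text \<open>A squared character sum runs over pairs of codewords; summed over words of weight
  \<open>k\<close>, each pair yields a Krawtchouk value at its distance. One factor
  \<open>1 / card Z\<close> belongs to the distance distribution, the other to its dual.\<close>

lemma dual_distance_distribution_eq: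
  assumes "Z \<subseteq> binary_cube n"
  shows "dual_distance_distribution n Z k =
    (\<Sum>u | u \<in> binary_cube n \<and> hamming_weight u = k. (code_transform Z u)\<^sup>2)"
proof -
  let ?c = "1 / real (card Z)"
  let ?U = "{u. u \<in> binary_cube n \<and> hamming_weight u = k}"
  have "(\<Sum>u\<in>?U. (code_transform Z u)\<^sup>2) =
      ?c\<^sup>2 * (\<Sum>u\<in>?U. \<Sum>z\<in>Z. \<Sum>z'\<in>Z. walsh u z * walsh u z')"
    unfolding code_transform_def power_mult_distrib sum_product[symmetric]
    by (simp only: power2_eq_square sum_distrib_left)
  also have "(\<Sum>u\<in>?U. \<Sum>z\<in>Z. \<Sum>z'\<in>Z. walsh u z * walsh u z') =
      (\<Sum>z\<in>Z. \<Sum>z'\<in>Z. \<Sum>u\<in>?U. walsh u z * walsh u z' :: real)"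
    by (subst sum.swap, rule sum.cong[OF refl], rule sum.swap)
  also have "\<dots> = (\<Sum>z\<in>Z. \<Sum>z'\<in>Z. krawtchouk n k (real (hamming_dist z z')))"
  proof (intro sum.cong refl)
    fix z z' assume "z \<in> Z" "z' \<in> Z"
    then have "length z = n" "length z' = n"
      using assms by (auto simp: binary_cube_def)
    then show "(\<Sum>u\<in>?U. walsh u z * walsh u z') = krawtchouk n k (real (hamming_dist z z'))"
      using hamming_dist_le[of z z']
      by (simp add: sum_walsh_eq_coeff_krawtchouk_gf krawtchouk_eq_coeff)
  qed
  also have "\<dots> = (\<Sum>i=0..n. krawtchouk n k (real i) *
      real (card {(z, z'). z \<in> Z \<and> z' \<in> Z \<and> hamming_dist z z' = i}))"
    by (rule sum_pairs_by_distance[OF assms])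
  finally show ?thesis
    by (simp add: dual_distance_distribution_def distance_distribution_def
        power2_eq_square sum_distrib_left mult_ac)
qed

lemma local_discrepancy_eq:
  assumes "Z \<subseteq> binary_cube n" and "card Z \<ge> 1" and "x \<in> binary_cube n"
  shows "(1 / real (card Z)) * (\<Sum>z\<in>Z. indicator (hamming_ball n x t) z)
          - real (card (hamming_ball n x t)) / 2 ^ n =
    (\<Sum>u\<in>binary_cube n - {replicate n False}.
      ball_coeff n t (hamming_weight u) * code_transform Z u / 2 ^ n * walsh u x)"
proof -
  let ?o = "replicate n False"
  let ?g = "\<lambda>u. ball_coeff n t (hamming_weight u) * code_transform Z u / 2 ^ n * walsh u x"
  have o: "?o \<in> binary_cube n" by (simp add: binary_cube_def)
  have "(\<Sum>z\<in>Z. indicator (hamming_ball n x t) z :: real) =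
      (\<Sum>z\<in>Z. \<Sum>u\<in>binary_cube n. walsh u x * walsh u z * ball_coeff n t (hamming_weight u)) / 2 ^ n"
    unfolding sum_divide_distrib[of _ Z] using assms
    by (intro sum.cong refl indicator_hamming_ball_eq) auto
  also have "(\<Sum>z\<in>Z. \<Sum>u\<in>binary_cube n. walsh u x * walsh u z * ball_coeff n t (hamming_weight u)) =
      (\<Sum>u\<in>binary_cube n. walsh u x * ball_coeff n t (hamming_weight u) * (\<Sum>z\<in>Z. walsh u z))"
    by (subst sum.swap) (simp add: sum_distrib_left sum_distrib_right mult_ac)
  finally have "(1 / real (card Z)) * (\<Sum>z\<in>Z. indicator (hamming_ball n x t) z) =
      (\<Sum>u\<in>binary_cube n. ?g u)"
    by (simp add: code_transform_def sum_distrib_left[of _ _ "binary_cube n"]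
        sum_divide_distrib[of _ "binary_cube n"] mult_ac)
  also have "\<dots> = ?g ?o + (\<Sum>u\<in>binary_cube n - {?o}. ?g u)"
    using o by (simp add: sum.remove)
  \<comment> \<open>Since \<open>Z\<close> is nonempty, \<open>code_transform Z ?o\<close> is 1, so
    this term is exactly the ball volume that the discrepancy subtracts.\<close>
  also have "?g ?o = real (card (hamming_ball n x t)) / 2 ^ n"
    using assms by (simp add: card_hamming_ball_eq code_transform_def hamming_weight_def)
  finally show ?thesis by simp
qed

section \<open>Summation over radii and weights\<close>

lemma krawtchouk_eq_0_of_degree:
  assumes "x \<le> m" and "m < k"
  shows "krawtchouk m k (real x) = 0"
  using assms degree_krawtchouk_gf_le[of x m] by (simp add: krawtchouk_eq_coeff coeff_eq_0)

theorem L2_discrepancy_eq_sum_krawtchouk_squares: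
  assumes "Z \<subseteq> binary_cube n" and "card Z \<ge> 1"
  shows "L2_discrepancy n Z =
           (1 / 2 ^ n) * (\<Sum>k=1..n. dual_distance_distribution n Z k *
              (\<Sum>t=0..n-1. (krawtchouk (n - 1) t (real k - 1))\<^sup>2))"
proof -
  let ?U = "binary_cube n - {replicate n False}"
  let ?h = "\<lambda>k. \<Sum>t=0..n. (ball_coeff n t k)\<^sup>2"
  have h: "?h k = (\<Sum>t=0..n-1. (krawtchouk (n - 1) t (real k - 1))\<^sup>2)" if k: "k \<in> {1..n}" for k
  proof -
    obtain m v where mv: "n = Suc m" "k = Suc v" "v \<le> m"
      using k by (cases n; cases k) auto
    then have "?h k = (\<Sum>t=0..Suc m. (krawtchouk m t (real v))\<^sup>2)"
      by (simp add: ball_coeff_eq_krawtchouk)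
    \<comment> \<open>Radius \<open>n = Suc m\<close> asks for a coefficient beyond the degree of
      the generating function for length \<open>m\<close>, so the last term vanishes.\<close>
    also have "\<dots> = (\<Sum>t=0..m. (krawtchouk m t (real v))\<^sup>2)"
      using mv by (simp add: krawtchouk_eq_0_of_degree)
    finally show ?thesis using mv by simp
  qed
  have U: "hamming_weight ` ?U \<subseteq> {1..n}"
    using hamming_weight_le hamming_weight_eq_0_iff by (fastforce simp: Suc_le_eq)
  have "L2_discrepancy n Z = (\<Sum>t=0..n. \<Sum>x\<in>binary_cube n. (\<Sum>u\<in>?U.
      ball_coeff n t (hamming_weight u) * code_transform Z u / 2 ^ n * walsh u x)\<^sup>2)"
    unfolding L2_discrepancy_def using local_discrepancy_eq[OF assms]
    by (intro sum.cong refl) simp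
  \<comment> \<open>Parseval for each radius separately; its \<open>2 ^ n\<close> against the square
    of \<open>1 / 2 ^ n\<close> leaves the prefactor.\<close>
  also have "\<dots> = (\<Sum>t=0..n. 2 ^ n * (\<Sum>u\<in>?U.
      (ball_coeff n t (hamming_weight u) * code_transform Z u / 2 ^ n)\<^sup>2))"
    by (intro sum.cong refl walsh_parseval) auto
  also have "\<dots> = (1 / 2 ^ n) * (\<Sum>t=0..n. \<Sum>u\<in>?U.
      (code_transform Z u)\<^sup>2 * (ball_coeff n t (hamming_weight u))\<^sup>2)"
    by (simp add: sum_distrib_left power2_eq_square mult_ac)
  also have "(\<Sum>t=0..n. \<Sum>u\<in>?U. (code_transform Z u)\<^sup>2 * (ball_coeff n t (hamming_weight u))\<^sup>2) =
      (\<Sum>u\<in>?U. (code_transform Z u)\<^sup>2 * ?h (hamming_weight u))"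
    by (subst sum.swap) (simp add: sum_distrib_left)
  also have "\<dots> = (\<Sum>k=1..n. \<Sum>u | u \<in> ?U \<and> hamming_weight u = k.
      (code_transform Z u)\<^sup>2 * ?h (hamming_weight u))"
    using U by (intro sum.group[symmetric]) auto
  also have "\<dots> = (\<Sum>k=1..n. dual_distance_distribution n Z k *
      (\<Sum>t=0..n-1. (krawtchouk (n - 1) t (real k - 1))\<^sup>2))"
  proof (intro sum.cong refl)
    fix k assume k: "k \<in> {1..n}"
    have "{u. u \<in> ?U \<and> hamming_weight u = k} = {u. u \<in> binary_cube n \<and> hamming_weight u = k}"
      using k by (auto simp: hamming_weight_def)
    then show "(\<Sum>u | u \<in> ?U \<and> hamming_weight u = k.
        (code_transform Z u)\<^sup>2 * ?h (hamming_weight u)) =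
        dual_distance_distribution n Z k * (\<Sum>t=0..n-1. (krawtchouk (n - 1) t (real k - 1))\<^sup>2)"
      by (simp add: dual_distance_distribution_eq[OF assms(1)] h[OF k, simplified]
          sum_distrib_right)
  qed
  finally show ?thesis .
qed

theorem theorem4p4:
  fixes n N :: nat and Z :: "bool list set"
  assumes "Z \<subseteq> binary_cube n" and "card Z = N" and "N \<ge> 1"
  shows "L2_discrepancy n Z =
           (1 / 2 ^ n) * (\<Sum>k=1..n. dual_distance_distribution n Z k *
              (\<Sum>t=0..n-1. (krawtchouk (n - 1) t (real k - 1))\<^sup>2))
       \<and> L2_discrepancy n Z =
           (1 / 2 ^ n) * (\<Sum>k=1..n. dual_distance_distribution n Z k *
              (\<Sum>i=0..(n - 1) div 2.
                 2 ^ (n - 1 - 2 * i) * real ((2 * i) choose i)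
                   * krawtchouk (n - 1) (2 * i) (real k - 1)))"
proof -
  have "(\<Sum>t=0..n-1. (krawtchouk (n - 1) t (real k - 1))\<^sup>2) =
      (\<Sum>i=0..(n - 1) div 2. 2 ^ (n - 1 - 2 * i) * real ((2 * i) choose i)
         * krawtchouk (n - 1) (2 * i) (real k - 1))" if "k \<in> {1..n}" for k
  proof -
    \<comment> \<open>For \<open>k \<ge> 1\<close> the truncated \<open>k - 1\<close> agrees with
      the real difference, so the sums of squares can be replaced term by term.\<close>
    have "k - 1 \<le> n - 1" and "real (k - 1) = real k - 1"
      using that by auto
    then show ?thesis
      using sum_krawtchouk_squares[of "k - 1" "n - 1"] by simp
  qed
  then show ?thesis
    using L2_discrepancy_eq_sum_krawtchouk_squares[of Z n] assms by simp
qed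

end
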